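(* For any diagonal section $\delta$ the following are equivalent: (i) $\overline{C}_\delta=K_\delta$; (ii) $\delta'(x)\in\{0,2\}$ for almost every $x$ in the set $\Lambda=\{x\in[0,1]:\delta(x)<x\}$.
   Context: $\mathbb{I}=[0,1]$. A (bivariate) copula is a function $C\colon\mathbb{I}^2\to\mathbb{I}$ with $C(x,0)=C(0,y)=0$, $C(x,1)=x$, $C(1,y)=y$ for all $x,y$, and $C(b,d)+C(a,c)-C(b,c)-C(a,d)\ge 0$ for all $a\le b$, $c\le d$. A diagonal section is a function $\delta\colon\mathbb{I}\to\mathbb{I}$ with $\delta(x)\le x$ for all $x$, $0\le\delta(y)-\delta(x)\le 2(y-x)$ whenever $x\le y$, and $\delta(1)=1$ (such $\delta$ is Lipschitz, hence differentiable a.e.). Define $\overline{C}_\delta(x,y)=\sup\{C(x,y): C \text{ a copula with } C(t,t)=\delta(t)\ \forall t\}$ and $K_\delta(x,y)=\sup\{C(x,y): C \text{ a copula with } C(x,y)=C(y,x) \text{ for all } x,y \text{ and } C(t,t)=\delta(t)\ \forall t\}$. *)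

theory Defs
  imports "HOL-Analysis.Analysis"
begin

definition copula :: "(real \<Rightarrow> real \<Rightarrow> real) \<Rightarrow> bool" where
  "copula C \<longleftrightarrow>
     (\<forall>x\<in>{0..1}. \<forall>y\<in>{0..1}. C x y \<in> {0..1}) \<and>
     (\<forall>x\<in>{0..1}. C x 0 = 0 \<and> C 0 x = 0 \<and> C x 1 = x \<and> C 1 x = x) \<and>
     (\<forall>a\<in>{0..1}. \<forall>b\<in>{0..1}. \<forall>c\<in>{0..1}. \<forall>d\<in>{0..1}.
        a \<le> b \<longrightarrow> c \<le> d \<longrightarrow> C b d + C a c - C b c - C a d \<ge> 0)"

definition diagonal_section :: "(real \<Rightarrow> real) \<Rightarrow> bool" where
  "diagonal_section \<delta> \<longleftrightarrow>
     (\<forall>x\<in>{0..1}. \<delta> x \<in> {0..1} \<and> \<delta> x \<le> x) \<and>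
     (\<forall>x\<in>{0..1}. \<forall>y\<in>{0..1}. x \<le> y \<longrightarrow> 0 \<le> \<delta> y - \<delta> x \<and> \<delta> y - \<delta> x \<le> 2 * (y - x)) \<and>
     \<delta> 1 = 1"

definition has_diagonal :: "(real \<Rightarrow> real \<Rightarrow> real) \<Rightarrow> (real \<Rightarrow> real) \<Rightarrow> bool" where
  "has_diagonal C \<delta> \<longleftrightarrow> (\<forall>t\<in>{0..1}. C t t = \<delta> t)"

definition symmetric_fn :: "(real \<Rightarrow> real \<Rightarrow> real) \<Rightarrow> bool" where
  "symmetric_fn C \<longleftrightarrow> (\<forall>x\<in>{0..1}. \<forall>y\<in>{0..1}. C x y = C y x)"

definition Cbar :: "(real \<Rightarrow> real) \<Rightarrow> real \<Rightarrow> real \<Rightarrow> real" where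
  "Cbar \<delta> x y = Sup {C x y | C. copula C \<and> has_diagonal C \<delta>}"

definition Ksym :: "(real \<Rightarrow> real) \<Rightarrow> real \<Rightarrow> real \<Rightarrow> real" where
  "Ksym \<delta> x y = Sup {C x y | C. copula C \<and> symmetric_fn C \<and> has_diagonal C \<delta>}"

end

theory Submission
  imports Defs
begin

text \<open>
  The symmetric bound is attained by the Fredricks-Nelsen copula
  $K_\delta(x,y) = \min\{x, y, (\delta(x)+\delta(y))/2\}$. For an arbitrary copula $C$ with
  diagonal section $\delta$ and $x \le s \le t$ one has
  $C(x,t) - C(x,s) \le \min\{t-s, \delta(t)-\delta(s)\}$, hence for $x \le y$
  $C(x,y) \le \min\{x, \delta(x) + \int_x^y \min\{1,\delta'\}\}$.
  Conversely, a single asymmetric copula attains this bound for all $x \le y$ simultaneously.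
  The bound agrees with $K_\delta$ exactly where $\min\{1,\delta'\} = \delta'/2$, that is
  $\delta' \in \{0,2\}$. If $[x,y]$ contains a fixed point of $\delta$, then both bounds equal $x$,
  so only the set $\delta(t) < t$ matters.
\<close>

section \<open>Densities of monotone Lipschitz functions\<close>

definition one_lipschitz_mono :: "(real \<Rightarrow> real) \<Rightarrow> bool" where
  "one_lipschitz_mono F \<longleftrightarrow> (\<forall>x y. x \<le> y \<longrightarrow> F x \<le> F y \<and> F y - F x \<le> y - x)"

text \<open>Continuity makes endpoints null, so the two Stieltjes measures together give every open
  interval its length, which characterises Lebesgue measure. Consequently the measure of
  \<open>F\<close> is dominated by Lebesgue measure.\<close>

lemma interval_measure_add_eq_lborel:
  fixes F G :: "real \<Rightarrow> real"
  assumes F: "mono F" "continuous_on UNIV F" and G: "mono G" "continuous_on UNIV G"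
    and A: "A \<in> sets borel" and FG: "\<And>x. F x + G x = x"
  shows "emeasure (interval_measure F) A + emeasure (interval_measure G) A = emeasure lborel A"
proof -
  let ?m = "\<lambda>A. emeasure (interval_measure F) A + emeasure (interval_measure G) A"
  \<comment> \<open>The sum is packaged as a measure so that uniqueness of Lebesgue measure applies
    to it.\<close>
  define T where "T = measure_of UNIV (sets borel) ?m"
  have sets_T: "sets T = sets borel"
    unfolding T_def by (simp add: sets.sigma_sets_eq[of borel, simplified])
  have em: "emeasure T B = ?m B" if "B \<in> sets borel" for B
  proof (rule emeasure_measure_of[OF T_def])
    show "countably_additive (sets T) ?m"
    proof (rule countably_additiveI)
      fix B :: "nat \<Rightarrow> real set"
      assume B: "range B \<subseteq> sets T" "disjoint_family B" "\<Union> (range B) \<in> sets T"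
      show "(\<Sum>i. ?m (B i)) = ?m (\<Union> (range B))"
        using B sets_T by (simp add: suminf_add[symmetric] suminf_emeasure)
    qed
  qed (use that sets_T in \<open>auto simp: positive_def\<close>)
  have "lborel = T"
  proof (rule lborel_eqI)
    fix l u :: real assume "\<And>b. b \<in> Basis \<Longrightarrow> l \<bullet> b \<le> u \<bullet> b"
    then have lu: "l \<le> u" by simp
    have Ioo: "emeasure (interval_measure H) {l<..<u} = ennreal (H u - H l)"
      if H: "mono H" "continuous_on UNIV H" for H
    proof (cases "l = u")
      case False
      have cr: "continuous (at_right a) H" for a
        using H by (auto simp: continuous_on_eq_continuous_within intro: continuous_within_subset)
      have Ioc: "emeasure (interval_measure H) {l<..u} = ennreal (H u - H l)"
        using lu H cr by (intro emeasure_interval_measure_Ioc) (auto simp: mono_def)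
      have "emeasure (interval_measure H) {u..u} = 0"
        using H by (subst emeasure_interval_measure_Icc) (auto simp: mono_def)
      then have "{u} \<in> null_sets (interval_measure H)"
        by (auto simp: null_sets_def)
      then have "emeasure (interval_measure H) ({l<..u} - {u}) = emeasure (interval_measure H) {l<..u}"
        by (intro emeasure_Diff_null_set) auto
      moreover have "{l<..u} - {u} = {l<..<u}" by auto
      ultimately show ?thesis using Ioc by simp
    qed simp
    have "F l \<le> F u" "G l \<le> G u" using lu F G by (auto simp: mono_def)
    moreover have "F u - F l + (G u - G l) = u - l" using FG[of u] FG[of l] by linarith
    ultimately show "emeasure T (box l u) = (\<Prod>b\<in>Basis. (u - l) \<bullet> b)"
      using Ioo[OF F] Ioo[OF G] by (simp add: em flip: ennreal_plus)
  qed (rule sets_T)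
  then show ?thesis using em[OF A] by simp
qed

section \<open>Almost everywhere differentiation of indefinite integrals\<close>

text \<open>Lebesgue differentiation over intervals [x, x + h] with h > 0 controls right difference
  quotients only; left ones are obtained by reflection below.\<close>

lemma AE_has_right_derivative_integral:
  fixes f :: "real \<Rightarrow> real"
  assumes int: "\<And>a b. a \<le> b \<Longrightarrow> (f has_integral (F b - F a)) {a..b}"
  shows "AE x in lborel. ((\<lambda>y. (F y - F x) / (y - x)) \<longlongrightarrow> f x) (at_right x)"
proof -
  have "f integrable_on cbox a b" for a b
    using int[of a b] by (cases "a \<le> b") (auto simp: has_integral_integrable)
  then obtain N where N: "negligible N" "\<And>x e. \<lbrakk>x \<notin> N; 0 < e\<rbrakk> \<Longrightarrow>
      \<exists>d>0. \<forall>h. 0 < h \<and> h < d \<longrightarrow>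
        norm (integral (cbox x (x + h *\<^sub>R One)) f /\<^sub>R h ^ DIM(real) - f x) < e"
    using integrable_ccontinuous_explicit[of f] by metis
  have lim: "((\<lambda>y. (F y - F x) / (y - x)) \<longlongrightarrow> f x) (at_right x)" if "x \<notin> N" for x
    unfolding tendsto_iff
  proof (intro allI impI)
    fix e :: real assume "0 < e"
    from N(2)[OF that this] obtain d where d: "d > 0"
      "\<And>h. 0 < h \<Longrightarrow> h < d \<Longrightarrow> norm (integral (cbox x (x + h *\<^sub>R One)) f /\<^sub>R h ^ DIM(real) - f x) < e"
      by blast
    have "dist ((F y - F x) / (y - x)) (f x) < e" if "x < y" "y < x + d" for y
    proof -
      have "integral {x..y} f = F y - F x"
        using int[of x y] that by (simp add: integral_unique)
      with d(2)[of "y - x"] that show ?thesis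
        by (simp add: dist_norm divide_inverse mult.commute)
    qed
    then show "\<forall>\<^sub>F y in at_right x. dist ((F y - F x) / (y - x)) (f x) < e"
      using d(1) by (intro eventually_at_rightI[of x "x + d"]) auto
  qed
  have "AE x in lebesgue. x \<notin> N"
    using N(1) by (simp add: AE_iff_null_sets negligible_iff_null_sets AE_not_in)
  then have "AE x in lborel. x \<notin> N"
    by (simp add: AE_completion_iff)
  then show ?thesis by eventually_elim (rule lim)
qed

lemma AE_lborel_reflect:
  assumes "AE x in lborel. P (x::real)"
  shows "AE x in lborel. P (- x)"
proof -
  have "AE x in distr lborel borel uminus. P x"
    using assms unfolding lborel_distr_uminus .
  then show ?thesis
    by (rule AE_distrD[rotated]) simp
qed

text \<open>The function -F(-x) is a primitive of f(-x), and its right derivative at -x is the left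
  derivative of \<open>F\<close> at x.\<close>

lemma AE_has_real_derivative_integral:
  fixes f :: "real \<Rightarrow> real"
  assumes int: "\<And>a b. a \<le> b \<Longrightarrow> (f has_integral (F b - F a)) {a..b}"
  shows "AE x in lborel. (F has_real_derivative f x) (at x)"
proof -
  have "((\<lambda>x. f (- x)) has_integral (- F (- b) - (- F (- a)))) {a..b}" if "a \<le> b" for a b
    using has_integral_reflect_lemma_real[OF int[of "-b" "-a"]] that by simp
  from AE_lborel_reflect[OF AE_has_right_derivative_integral[of "\<lambda>x. f (-x)" "\<lambda>x. - F (-x)", OF this]]
  have "AE x in lborel. ((\<lambda>y. (- F (- y) + F x) / (y + x)) \<longlongrightarrow> f x) (at_right (- x))"
    by simp
  moreover have "AE x in lborel. ((\<lambda>y. (F y - F x) / (y - x)) \<longlongrightarrow> f x) (at_right x)"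
    by (rule AE_has_right_derivative_integral[OF int])
  ultimately show ?thesis
  proof eventually_elim
    case (elim x)
    have "((\<lambda>y. (F y - F x) / (y - x)) \<longlongrightarrow> f x) (at_left x)"
    proof -
      have "((\<lambda>y. (- F y + F x) / (- y + x)) \<longlongrightarrow> f x) (at_left x)"
        using elim(1) unfolding at_left_minus[of x] filterlim_filtermap by simp
      moreover have "(- F y + F x) / (- y + x) = (F y - F x) / (y - x)" for y
        by (metis add.commute minus_diff_eq minus_divide_divide uminus_add_conv_diff)
      ultimately show ?thesis by simp
    qed
    with elim(2) show ?case
      unfolding has_field_derivative_iff by (intro filterlim_split_at)
  qed
qed

lemma one_lipschitz_mono_derivative_bounds:
  assumes F: "one_lipschitz_mono F" and d: "(F has_real_derivative d) (at x)"
  shows "0 \<le> d" "d \<le> 1"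
proof -
  have lim: "((\<lambda>y. (F y - F x) / (y - x)) \<longlongrightarrow> d) (at_right x)"
    using d unfolding has_field_derivative_iff by (rule filterlim_mono) (auto simp: at_le)
  have "0 \<le> (F y - F x) / (y - x) \<and> (F y - F x) / (y - x) \<le> 1" if "x < y" for y
    using F that unfolding one_lipschitz_mono_def by (auto simp: divide_le_eq_1)
  then have ev: "\<forall>\<^sub>F y in at_right x. 0 \<le> (F y - F x) / (y - x)"
    "\<forall>\<^sub>F y in at_right x. (F y - F x) / (y - x) \<le> 1"
    by (auto simp: eventually_at_filter)
  show "0 \<le> d" using tendsto_lowerbound[OF lim ev(1)] by simp
  show "d \<le> 1" using tendsto_upperbound[OF lim ev(2)] by simp
qed

lemma one_lipschitz_mono_continuous:
  assumes "one_lipschitz_mono F"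
  shows "continuous_on UNIV F"
proof (rule continuous_onI)
  fix x e :: real assume "e > 0"
  moreover have "dist (F y) (F x) \<le> dist y x" for y
    using assms unfolding one_lipschitz_mono_def dist_real_def by (smt (verit))
  ultimately show "\<exists>d>0. \<forall>x'\<in>UNIV. dist x' x < d \<longrightarrow> dist (F x') (F x) \<le> e"
    by (intro exI[of _ e]) (auto intro: order_trans less_imp_le)
qed

text \<open>Since \<open>F\<close> and id - \<open>F\<close> are both nondecreasing, the Stieltjes
  measure of \<open>F\<close> is at most Lebesgue measure, and Radon-Nikodym provides a
  density.\<close>

lemma one_lipschitz_mono_density:
  assumes F: "one_lipschitz_mono F"
  obtains q where "\<And>x. 0 \<le> q x" "\<And>x. q x \<le> 1"
    "\<And>a b. a \<le> b \<Longrightarrow> (q has_integral (F b - F a)) {a..b}"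
proof -
  let ?G = "\<lambda>x. x - F x"
  let ?M = "interval_measure F"
  have G: "one_lipschitz_mono ?G" using F unfolding one_lipschitz_mono_def by (smt (verit))
  have mono: "mono F" "mono ?G" using F G unfolding one_lipschitz_mono_def mono_def by auto
  note cont = one_lipschitz_mono_continuous[OF F] one_lipschitz_mono_continuous[OF G]
  have cr: "continuous (at_right a) F" for a
    using cont(1) by (auto simp: continuous_on_eq_continuous_within intro: continuous_within_subset)
  have ac: "absolutely_continuous lborel ?M"
    unfolding absolutely_continuous_def
  proof
    fix A assume A: "A \<in> null_sets (lborel :: real measure)"
    then have "A \<in> sets borel" by auto
    from interval_measure_add_eq_lborel[OF mono(1) cont(1) mono(2) cont(2) this] A
    show "A \<in> null_sets ?M" by (intro null_setsI) auto
  qed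
  have sf: "sigma_finite_measure ?M"
    using mono cr by (intro sigma_finite_interval_measure) (auto simp: mono_def)
  define f where "f = RN_deriv lborel ?M"
  have f [measurable]: "f \<in> borel_measurable borel"
    using borel_measurable_RN_deriv[of lborel ?M] by (simp add: f_def)
  have dens: "density lborel f = ?M"
    unfolding f_def by (rule sigma_finite_measure.density_RN_deriv[OF lborel.sigma_finite_measure_axioms ac]) simp
  have fin: "AE x in lborel. f x \<noteq> \<infinity>"
    unfolding f_def by (rule sigma_finite_measure.RN_deriv_finite[OF lborel.sigma_finite_measure_axioms sf ac]) simp
  \<comment> \<open>\<open>enn2real\<close> sends infinity to 0, which is harmless because the
    Radon-Nikodym derivative is finite almost everywhere.\<close>
  define p where "p x = enn2real (f x)" for x
  have [measurable]: "p \<in> borel_measurable borel" unfolding p_def by measurable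
  have p_int: "(p has_integral (F b - F a)) {a..b}" if "a \<le> b" for a b
  proof -
    have "(\<integral>\<^sup>+x. ennreal (if x \<in> {a..b} then p x else 0) \<partial>lborel) = (\<integral>\<^sup>+x. f x * indicator {a..b} x \<partial>lborel)"
      using fin by (intro nn_integral_cong_AE) (auto simp: p_def top.not_eq_extremum indicator_def)
    also have "\<dots> = emeasure ?M {a..b}"
      by (subst dens[symmetric], subst emeasure_density) auto
    also have "\<dots> = ennreal (F b - F a)"
      using that mono cont by (intro emeasure_interval_measure_Icc) (auto simp: mono_def)
    finally have "((\<lambda>x. if x \<in> {a..b} then p x else 0) has_integral (F b - F a)) UNIV"
      using that mono by (subst has_integral_iff_nn_integral_lebesgue)
        (auto simp: nn_integral_completion p_def mono_def intro!: measurable_completion)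
    then show ?thesis by (simp only: has_integral_restrict_UNIV)
  qed
  \<comment> \<open>The density equals the derivative of \<open>F\<close> almost everywhere and so
    lies in [0,1] there; truncation gives the bounds at every point without changing any
    integral.\<close>
  define q where "q x = max 0 (min 1 (p x))" for x
  have "AE x in lborel. (F has_real_derivative p x) (at x)"
    by (rule AE_has_real_derivative_integral[OF p_int])
  then have "AE x in lborel. q x = p x"
  proof eventually_elim
    case (elim x)
    from one_lipschitz_mono_derivative_bounds[OF F elim] show ?case by (simp add: q_def)
  qed
  then have "(q has_integral I) S \<longleftrightarrow> (p has_integral I) S" for I S
    by (intro has_integral_AE) auto
  then show ?thesis
    using p_int by (intro that[of q]) (auto simp: q_def)
qed

lemma one_lipschitz_monoI_density:
  assumes "\<And>x. 0 \<le> q x" "\<And>x. q x \<le> 1"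
    and "\<And>a b. a \<le> b \<Longrightarrow> (q has_integral (F b - F a)) {a..b}"
  shows "one_lipschitz_mono F"
  unfolding one_lipschitz_mono_def
proof (intro allI impI)
  fix x y :: real assume "x \<le> y"
  with has_integral_le[OF has_integral_0 assms(3)[of x y]]
    has_integral_le[OF assms(3)[of x y] has_integral_const_real[of 1 x y]]
  show "F x \<le> F y \<and> F y - F x \<le> y - x"
    using assms(1,2) by auto
qed

section \<open>Primitives and comparison of densities\<close>

lemma indefinite_integral_exists:
  fixes g :: "real \<Rightarrow> real"
  assumes g: "\<And>a b. g integrable_on {a..b}"
  obtains G where "G 0 = 0" "\<And>a b. a \<le> b \<Longrightarrow> (g has_integral (G b - G a)) {a..b}"
proof -
  \<comment> \<open>An integral over a reversed interval is 0, so this is the signed integral from 0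
    to t for either sign of t.\<close>
  let ?G = "\<lambda>t. integral {0..t} g - integral {t..0} g"
  have "integral {a..b} g = ?G b - ?G a" if ab: "a \<le> b" for a b
    using Henstock_Kurzweil_Integration.integral_combine[of 0 a b g]
      Henstock_Kurzweil_Integration.integral_combine[of a 0 b g]
      Henstock_Kurzweil_Integration.integral_combine[of a b 0 g] g ab
    by (cases "0 = a"; cases "0 = b"; cases "0 < a"; cases "0 < b") auto
  with integrable_integral[OF g] have "(g has_integral (?G b - ?G a)) {a..b}" if "a \<le> b" for a b
    using that by metis
  then show thesis by (intro that[of ?G]) auto
qed

lemma has_integral_le_AE:
  fixes f g :: "real \<Rightarrow> real"
  assumes "(f has_integral i) S" "(g has_integral j) S" "AE x in lborel. x \<in> S \<longrightarrow> f x \<le> g x"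
  shows "i \<le> j"
proof -
  have "AE x in lborel. x \<in> S \<longrightarrow> f x = min (f x) (g x)"
    using assms(3) by eventually_elim auto
  from has_integral_AE[OF this] assms(1) have "((\<lambda>x. min (f x) (g x)) has_integral i) S"
    by simp
  then show ?thesis using assms(2) by (rule has_integral_le) simp
qed

text \<open>Given differentiability, increments to the right decide. This turns increment estimates
  for copulas into inequalities between densities.\<close>

lemma derivative_le_right:
  fixes F G :: "real \<Rightarrow> real"
  assumes "(F has_real_derivative a) (at x)" "(G has_real_derivative b) (at x)"
    and le: "\<forall>\<^sub>F y in at_right x. F y - F x \<le> G y - G x"
  shows "a \<le> b"
proof (rule tendsto_le)
  show "((\<lambda>y. (G y - G x) / (y - x)) \<longlongrightarrow> b) (at_right x)"
    "((\<lambda>y. (F y - F x) / (y - x)) \<longlongrightarrow> a) (at_right x)"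
    using assms(1,2) unfolding has_field_derivative_iff by (auto elim: filterlim_mono simp: at_le)
  have "\<forall>\<^sub>F y in at_right x. x < y" by (simp add: eventually_at_filter)
  with le show "\<forall>\<^sub>F y in at_right x. (F y - F x) / (y - x) \<le> (G y - G x) / (y - x)"
    by eventually_elim (simp add: divide_right_mono)
qed simp

section \<open>Copulas with a given diagonal section\<close>

text \<open>A copula with diagonal section $\delta$ puts mass $u(s)\,ds$ below the diagonal in column $s$ and
  mass $w(t)\,dt$ above the diagonal in row $t$, where $u + w = \delta'$. Here $U$ and $W$ are the
  primitives of $u$ and $w$, and the remaining marginals on either side of the diagonal are coupled
  comonotonically; $U + W \le \mathrm{id}$ keeps each coupling on its side.\<close>
definition split_copula :: "(real \<Rightarrow> real) \<Rightarrow> (real \<Rightarrow> real) \<Rightarrow> real \<Rightarrow> real \<Rightarrow> real" where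
  "split_copula U W s t = min (s - U s) (W t) + min (U s) (t - W t)"

lemma min_two_increasing:
  fixes a b c d :: real
  assumes "a \<le> b" "c \<le> d"
  shows "min b d + min a c - min b c - min a d \<ge> 0"
  using assms by (auto simp: min_def)

lemma copulaI:
  assumes bd: "\<And>x. x \<in> {0..1} \<Longrightarrow> C x 0 = 0 \<and> C 0 x = 0 \<and> C x 1 = x \<and> C 1 x = x"
    and inc: "\<And>a b c d. \<lbrakk>0 \<le> a; a \<le> b; b \<le> 1; 0 \<le> c; c \<le> d; d \<le> 1\<rbrakk>
      \<Longrightarrow> C b d + C a c - C b c - C a d \<ge> 0"
  shows "copula C"
proof -
  \<comment> \<open>The range follows from the nonnegative mass of [0,x] x [0,y] and [x,1] x
    [0,y].\<close>
  have "C x y \<in> {0..1}" if "x \<in> {0..1}" "y \<in> {0..1}" for x y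
    using inc[of 0 x 0 y] inc[of x 1 0 y] bd[of x] bd[of y] bd[of 0] bd[of 1] that by auto
  with bd inc show ?thesis
    unfolding copula_def by auto
qed

text \<open>Each summand is a minimum of a nondecreasing function of s and one of t, hence
  2-increasing. The marginals fit because \<open>U 1 + W 1 = 1\<close> gives s - U s \<le> W 1 and U
  s \<le> 1 - W 1, and likewise with the roles exchanged.\<close>

lemma copula_split_copula:
  assumes U: "one_lipschitz_mono U" "U 0 = 0" and W: "one_lipschitz_mono W" "W 0 = 0"
    and le: "\<And>x. x \<in> {0..1} \<Longrightarrow> U x + W x \<le> x" and "U 1 + W 1 = 1"
  shows "copula (split_copula U W)"
proof (rule copulaI)
  fix x :: real assume x: "x \<in> {0..1}"
  then have "0 \<le> U x" "U x \<le> x" "U x \<le> U 1" "U 1 - U x \<le> 1 - x"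
    "0 \<le> W x" "W x \<le> x" "W x \<le> W 1" "W 1 - W x \<le> 1 - x"
    using U W unfolding one_lipschitz_mono_def by (metis atLeastAtMost_iff diff_zero)+
  then show "split_copula U W x 0 = 0 \<and> split_copula U W 0 x = 0
    \<and> split_copula U W x 1 = x \<and> split_copula U W 1 x = x"
    using U(2) W(2) assms(6) by (auto simp: split_copula_def min_def)
next
  fix a b c d :: real assume "a \<le> b" "c \<le> d"
  then have "a - U a \<le> b - U b" "U a \<le> U b" "W c \<le> W d" "c - W c \<le> d - W d"
    using U W unfolding one_lipschitz_mono_def by (smt (verit))+
  then show "split_copula U W b d + split_copula U W a c - split_copula U W b c - split_copula U W a d \<ge> 0"
    using min_two_increasing[of "a - U a" "b - U b" "W c" "W d"]
      min_two_increasing[of "U a" "U b" "c - W c" "d - W d"]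
    unfolding split_copula_def by linarith
qed

text \<open>Here U s \<le> U t \<le> t - W t, so the second minimum is U s, which is then absorbed
  into the first.\<close>

lemma split_copula_above_diagonal:
  assumes "one_lipschitz_mono U" "U t + W t \<le> t" "s \<le> t"
  shows "split_copula U W s t = min s (U s + W t)"
  using assms unfolding one_lipschitz_mono_def split_copula_def by (smt (verit))

section \<open>Estimates valid for every copula\<close>

lemma copula_transpose:
  assumes "copula C"
  shows "copula (\<lambda>x y. C y x)"
proof (rule copulaI)
  fix a b c d :: real assume "0 \<le> a" "a \<le> b" "b \<le> 1" "0 \<le> c" "c \<le> d" "d \<le> 1"
  then have "C d b + C c a - C d a - C c b \<ge> 0"
    using assms unfolding copula_def by auto
  then show "C d b + C c a - C c b - C d a \<ge> 0" by linarith
qed (use assms in \<open>auto simp: copula_def\<close>)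

text \<open>The rectangles [0,x] x [s,t] and [x,1] x [s,t] have nonnegative masses that add up to t
  - s.\<close>

lemma copula_mono_lipschitz:
  assumes "copula C" "x \<in> {0..1}" "0 \<le> s" "s \<le> t" "t \<le> 1"
  shows "C x s \<le> C x t" "C x t - C x s \<le> t - s"
proof -
  have bd: "\<And>z. z \<in> {0..1} \<Longrightarrow> C 0 z = 0 \<and> C 1 z = z"
    and inc: "\<And>a b c d. \<lbrakk>a\<in>{0..1}; b\<in>{0..1}; c\<in>{0..1}; d\<in>{0..1}; a \<le> b; c \<le> d\<rbrakk>
      \<Longrightarrow> C b d + C a c - C b c - C a d \<ge> 0"
    using assms(1) unfolding copula_def by auto
  show "C x s \<le> C x t" "C x t - C x s \<le> t - s"
    using inc[of 0 x s t] inc[of x 1 s t] bd[of s] bd[of t] assms(2-) by auto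
qed

lemma copula_le_min:
  assumes "copula C" "x \<in> {0..1}" "y \<in> {0..1}"
  shows "C x y \<le> x" "C x y \<le> y"
  using copula_mono_lipschitz[OF assms(1,2), of y 1]
    copula_mono_lipschitz[OF copula_transpose[OF assms(1)] assms(3), of x 1] assms
  unfolding copula_def by auto

text \<open>The rectangles $[0,x] \times [s,t]$ and $[s,t] \times [0,s]$ and the square $[s,t]^2$ are
  disjoint parts of $[0,t]^2 \setminus [0,s]^2$ when $x \le s$.\<close>
lemma copula_increment_le_diagonal:
  assumes C: "copula C" "has_diagonal C \<delta>" and "0 \<le> x" "x \<le> s" "s \<le> t" "t \<le> 1"
  shows "C x t - C x s \<le> \<delta> t - \<delta> s"
proof -
  have inc: "\<And>a b c d. \<lbrakk>a\<in>{0..1}; b\<in>{0..1}; c\<in>{0..1}; d\<in>{0..1}; a \<le> b; c \<le> d\<rbrakk>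
      \<Longrightarrow> C b d + C a c - C b c - C a d \<ge> 0"
    using C unfolding copula_def by auto
  have "C s s \<le> C t s"
    using copula_mono_lipschitz[OF copula_transpose[OF C(1)], of s s t] assms by auto
  moreover have "C s s = \<delta> s" "C t t = \<delta> t"
    using C assms unfolding has_diagonal_def by auto
  ultimately show ?thesis
    using inc[of x t s t] assms by auto
qed

section \<open>The largest symmetric copula with a given diagonal section\<close>

definition diagonal_copula :: "(real \<Rightarrow> real) \<Rightarrow> real \<Rightarrow> real \<Rightarrow> real" where
  "diagonal_copula \<delta> x y = min (min x y) ((\<delta> x + \<delta> y) / 2)"

text \<open>The square [a,b] x [a,b] has nonnegative mass, which by symmetry is \<delta> a +
  \<delta> b - 2 C(a,b).\<close>

lemma symmetric_copula_le_diagonal_copula: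
  assumes C: "copula C" "has_diagonal C \<delta>" "symmetric_fn C" and "x \<in> {0..1}" "y \<in> {0..1}"
  shows "C x y \<le> diagonal_copula \<delta> x y"
proof -
  have le: "C a b \<le> diagonal_copula \<delta> a b" if "a \<in> {0..1}" "b \<in> {0..1}" "a \<le> b" for a b
  proof -
    have "C b b + C a a - C b a - C a b \<ge> 0"
      using C(1) that unfolding copula_def by auto
    moreover have "C b a = C a b" "C b b = \<delta> b" "C a a = \<delta> a"
      using C that unfolding has_diagonal_def symmetric_fn_def by auto
    ultimately show ?thesis
      using copula_le_min[OF C(1) that(1,2)] by (simp add: diagonal_copula_def)
  qed
  moreover have "C x y = C y x" "diagonal_copula \<delta> x y = diagonal_copula \<delta> y x"
    using C assms by (auto simp: symmetric_fn_def diagonal_copula_def min.commute add.commute)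
  ultimately show ?thesis using le[of x y] le[of y x] assms by fastforce
qed

text \<open>Composition with this map extends functions on the unit interval to the whole line,
  constantly on either side, so that monotonicity and Lipschitz bounds survive.\<close>

definition clamp01 :: "real \<Rightarrow> real" where
  "clamp01 t = max 0 (min 1 t)"

lemma clamp01_eq: "x \<in> {0..1} \<Longrightarrow> clamp01 x = x"
  by (auto simp: clamp01_def)

lemma diagonal_section_0: "diagonal_section \<delta> \<Longrightarrow> \<delta> 0 = 0"
  unfolding diagonal_section_def by force

lemma one_lipschitz_mono_clamp:
  assumes "\<And>x y. \<lbrakk>0 \<le> x; x \<le> y; y \<le> 1\<rbrakk> \<Longrightarrow> F x \<le> F y \<and> F y - F x \<le> y - x"
  shows "one_lipschitz_mono (\<lambda>t. F (clamp01 t))"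
  unfolding one_lipschitz_mono_def
proof (intro allI impI)
  fix x y :: real assume "x \<le> y"
  then have "clamp01 x \<le> clamp01 y" "0 \<le> clamp01 x" "clamp01 y \<le> 1"
    "clamp01 y - clamp01 x \<le> y - x"
    by (auto simp: clamp01_def)
  then show "F (clamp01 x) \<le> F (clamp01 y) \<and> F (clamp01 y) - F (clamp01 x) \<le> y - x"
    using assms[of "clamp01 x" "clamp01 y"] by auto
qed

text \<open>Halving brings the Lipschitz constant 2 of \<delta> down to 1, so the density lemma
  applies and yields \<delta>'/2.\<close>

lemma one_lipschitz_mono_half_diagonal:
  assumes "diagonal_section \<delta>"
  shows "one_lipschitz_mono (\<lambda>t. \<delta> (clamp01 t) / 2)"
proof (rule one_lipschitz_mono_clamp)
  fix x y :: real assume "0 \<le> x" "x \<le> y" "y \<le> 1"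
  with assms have "0 \<le> \<delta> y - \<delta> x" "\<delta> y - \<delta> x \<le> 2 * (y - x)"
    unfolding diagonal_section_def by auto
  then show "\<delta> x / 2 \<le> \<delta> y / 2 \<and> \<delta> y / 2 - \<delta> x / 2 \<le> y - x" by auto
qed

lemma copula_cong:
  assumes "copula C" "\<And>x y. x \<in> {0..1} \<Longrightarrow> y \<in> {0..1} \<Longrightarrow> C x y = D x y"
  shows "copula D"
  using assms(1) unfolding copula_def by (simp add: assms(2))

text \<open>This is the split copula that shares \<delta>' equally between the two sides of the
  diagonal.\<close>

lemma diagonal_copula:
  assumes \<delta>: "diagonal_section \<delta>"
  shows "copula (diagonal_copula \<delta>)" "has_diagonal (diagonal_copula \<delta>) \<delta>"
    "symmetric_fn (diagonal_copula \<delta>)"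
proof -
  let ?U = "\<lambda>t. \<delta> (clamp01 t) / 2"
  have le: "\<delta> x \<le> x" if "x \<in> {0..1}" for x
    using \<delta> that unfolding diagonal_section_def by auto
  show "symmetric_fn (diagonal_copula \<delta>)"
    by (auto simp: symmetric_fn_def diagonal_copula_def min.commute add.commute)
  show "has_diagonal (diagonal_copula \<delta>) \<delta>"
    using le by (auto simp: has_diagonal_def diagonal_copula_def)
  have U: "one_lipschitz_mono ?U" by (rule one_lipschitz_mono_half_diagonal[OF \<delta>])
  note [simp] = clamp01_eq
  have "copula (split_copula ?U ?U)"
    using \<delta> diagonal_section_0[OF \<delta>] le
    by (intro copula_split_copula[OF U _ U]) (auto simp: diagonal_section_def)
  then show "copula (diagonal_copula \<delta>)"
  proof (rule copula_cong)
    fix x y :: real assume xy: "x \<in> {0..1}" "y \<in> {0..1}"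
    have *: "split_copula ?U ?U a b = diagonal_copula \<delta> a b" "split_copula ?U ?U b a = diagonal_copula \<delta> b a"
      if "a \<in> {0..1}" "b \<in> {0..1}" "a \<le> b" for a b
    proof -
      have m: "\<delta> a \<le> \<delta> b" using \<delta> that unfolding diagonal_section_def by auto
      \<comment> \<open>Hence the larger argument b drops out of the minimum.\<close>
      then have "\<delta> a + \<delta> b \<le> 2 * b" using le[of b] that by auto
      then have "diagonal_copula \<delta> a b = min a ((\<delta> a + \<delta> b) / 2)" 
        "diagonal_copula \<delta> b a = min a ((\<delta> a + \<delta> b) / 2)"
        using that unfolding diagonal_copula_def by (auto simp: min_def add.commute)
      then show "split_copula ?U ?U a b = diagonal_copula \<delta> a b" "split_copula ?U ?U b a = diagonal_copula \<delta> b a"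
        using that m le[of b] unfolding split_copula_def
        by (auto simp: min_def field_simps)
    qed
    show "split_copula ?U ?U x y = diagonal_copula \<delta> x y"
      using *(1)[of x y] *(2)[of y x] xy by fastforce
  qed
qed

section \<open>From suprema to a pointwise inequality\<close>

lemma bdd_above_copula_values:
  assumes "x \<in> {0..1}" "y \<in> {0..1}"
  shows "bdd_above {C x y | C. copula C \<and> P C}"
  using assms copula_le_min(1) by (intro bdd_aboveI[of _ x]) auto

lemma Ksym_eq_diagonal_copula:
  assumes \<delta>: "diagonal_section \<delta>" and "x \<in> {0..1}" "y \<in> {0..1}"
  shows "Ksym \<delta> x y = diagonal_copula \<delta> x y"
  unfolding Ksym_def
  using diagonal_copula[OF \<delta>] symmetric_copula_le_diagonal_copula assms
  by (intro cSup_eq_maximum) auto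

lemma copula_le_Cbar:
  assumes "copula C" "has_diagonal C \<delta>" "x \<in> {0..1}" "y \<in> {0..1}"
  shows "C x y \<le> Cbar \<delta> x y"
  unfolding Cbar_def using assms
  by (intro cSup_upper bdd_above_copula_values) auto

text \<open>The supremum \<open>Ksym\<close> is attained by \<open>diagonal_copula\<close>, so
  equality means that no copula with this diagonal exceeds it. Transposition preserves the diagonal,
  which reduces the claim to x \<le> y.\<close>

lemma Cbar_eq_Ksym_iff:
  assumes \<delta>: "diagonal_section \<delta>"
  shows "(\<forall>x\<in>{0..1}. \<forall>y\<in>{0..1}. Cbar \<delta> x y = Ksym \<delta> x y) \<longleftrightarrow>
    (\<forall>C x y. copula C \<and> has_diagonal C \<delta> \<and> 0 \<le> x \<and> x \<le> y \<and> y \<le> 1 \<longrightarrow> C x y \<le> diagonal_copula \<delta> x y)"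
    (is "?L \<longleftrightarrow> ?R")
proof
  assume ?L
  then show ?R
    using copula_le_Cbar Ksym_eq_diagonal_copula[OF \<delta>] by fastforce
next
  assume R: ?R
  show ?L
  proof (intro ballI antisym)
    fix x y :: real assume xy: "x \<in> {0..1}" "y \<in> {0..1}"
    show "Ksym \<delta> x y \<le> Cbar \<delta> x y"
      using copula_le_Cbar[OF diagonal_copula(1,2)[OF \<delta>]] xy by (simp add: Ksym_eq_diagonal_copula[OF \<delta>])
    have "C x y \<le> diagonal_copula \<delta> x y" if C: "copula C" "has_diagonal C \<delta>" for C
    proof (cases "x \<le> y")
      case True
      then show ?thesis using R C xy by auto
    next
      case False
      have "has_diagonal (\<lambda>x y. C y x) \<delta>" using C by (auto simp: has_diagonal_def)
      with R copula_transpose[OF C(1)] False xy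
      have "(\<lambda>x y. C y x) y x \<le> diagonal_copula \<delta> y x"
        by (metis (no_types, lifting) atLeastAtMost_iff nle_le)
      then show ?thesis by (simp add: diagonal_copula_def min.commute add.commute)
    qed
    then show "Cbar \<delta> x y \<le> Ksym \<delta> x y"
      unfolding Cbar_def Ksym_eq_diagonal_copula[OF \<delta> xy]
      using diagonal_copula(1,2)[OF \<delta>] by (intro cSup_least) auto
  qed
qed

section \<open>Comparison of the two bounds\<close>

text \<open>Near an interior point the clamp is the identity. At 0 and 1 it discards the values of
  \<delta> outside the unit interval, so those points are excluded.\<close>

lemma half_diagonal_derivative_iff:
  assumes "0 < t" "t < 1"
  shows "((\<lambda>t. \<delta> (clamp01 t) / 2) has_real_derivative q) (at t) \<longleftrightarrow> (\<delta> has_real_derivative (2 * q)) (at t)"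
proof -
  have ev: "\<forall>\<^sub>F s in nhds t. s \<in> {0<..<1}"
    using assms by (intro eventually_nhds_in_open) auto
  have "((\<lambda>t. \<delta> (clamp01 t) / 2) has_real_derivative q) (at t) \<longleftrightarrow>
      ((\<lambda>t. \<delta> t / 2) has_real_derivative q) (at t)"
    using ev by (intro DERIV_cong_ev) (auto elim!: eventually_mono simp: clamp01_eq)
  also have "\<dots> \<longleftrightarrow> (\<delta> has_real_derivative (2 * q)) (at t)"
    using DERIV_cmult[of "\<lambda>t. \<delta> t / 2" q t UNIV 2] DERIV_cdivide[of \<delta> "2 * q" t UNIV 2]
    by auto
  finally show ?thesis .
qed

text \<open>The Lipschitz bound gives \<delta> x \<ge> 2 x - t and monotonicity gives \<delta> y
  \<ge> t, so their average is at least x, which bounds every copula.\<close>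

lemma copula_le_diagonal_copula_if_fixpoint:
  assumes \<delta>: "diagonal_section \<delta>" and C: "copula C" and t: "0 \<le> x" "x \<le> t" "t \<le> y" "y \<le> 1" "\<delta> t = t"
  shows "C x y \<le> diagonal_copula \<delta> x y"
proof -
  have "x \<in> {0..1}" "t \<in> {0..1}" "y \<in> {0..1}" using t by auto
  then have "\<delta> t - \<delta> x \<le> 2 * (t - x)" "0 \<le> \<delta> y - \<delta> t"
    using \<delta> t(2,3) unfolding diagonal_section_def by blast+
  then have "2 * x \<le> \<delta> x + \<delta> y" using t by auto
  with copula_le_min[OF C, of x y] t show ?thesis by (simp add: diagonal_copula_def)
qed

text \<open>The section t \<mapsto> C x t starts from \<delta> x at t = x and grows at rate at most
  min(1, \<delta>'), which is \<delta>'/2 under the hypothesis; integration over [x,y] gives the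
  bound.\<close>

lemma copula_le_diagonal_copula_if_derivative_0_2:
  assumes \<delta>: "diagonal_section \<delta>" and C: "copula C" "has_diagonal C \<delta>"
    and xy: "0 \<le> x" "x \<le> y" "y \<le> 1"
    and AE: "AE t in lborel. t \<in> {x<..<y} \<longrightarrow> (\<exists>d\<in>{0, 2}. (\<delta> has_real_derivative d) (at t))"
  shows "C x y \<le> diagonal_copula \<delta> x y"
proof -
  let ?D = "\<lambda>t. \<delta> (clamp01 t) / 2" and ?\<Phi> = "\<lambda>t. C x (clamp01 t)"
  have D: "one_lipschitz_mono ?D" by (rule one_lipschitz_mono_half_diagonal[OF \<delta>])
  have \<Phi>: "one_lipschitz_mono ?\<Phi>"
    using copula_mono_lipschitz[OF C(1)] xy by (intro one_lipschitz_mono_clamp) auto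
  obtain q where q: "\<And>a b. a \<le> b \<Longrightarrow> (q has_integral (?D b - ?D a)) {a..b}"
    using one_lipschitz_mono_density[OF D] by metis
  obtain \<phi> where \<phi>: "\<And>a b. a \<le> b \<Longrightarrow> (\<phi> has_integral (?\<Phi> b - ?\<Phi> a)) {a..b}"
    using one_lipschitz_mono_density[OF \<Phi>] by metis
  have D': "AE t in lborel. (?D has_real_derivative q t) (at t)"
    by (rule AE_has_real_derivative_integral[OF q])
  have \<Phi>': "AE t in lborel. (?\<Phi> has_real_derivative \<phi> t) (at t)"
    by (rule AE_has_real_derivative_integral[OF \<phi>])
  have "AE t in lborel. t \<noteq> x \<and> t \<noteq> y"
    using AE_lborel_singleton[of x] AE_lborel_singleton[of y] by eventually_elim auto
  with AE D' \<Phi>' have "AE t in lborel. t \<in> {x..y} \<longrightarrow> \<phi> t \<le> q t"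
  proof eventually_elim
    case (elim t)
    show ?case
    proof
      assume "t \<in> {x..y}"
      with elim(4) have t: "x < t" "t < y" by auto
      then have t01: "0 < t" "t < 1" using xy by auto
      from elim(1) t obtain d where d: "d \<in> {0, 2}" "(\<delta> has_real_derivative d) (at t)" by auto
      have "(\<delta> has_real_derivative (2 * q t)) (at t)"
        using elim(2) half_diagonal_derivative_iff[OF t01] by simp
      with d(2) have dq: "d = 2 * q t" by (rule DERIV_unique)
      have "\<phi> t \<le> d"
      proof (rule derivative_le_right[OF elim(3) d(2)])
        have "?\<Phi> s - ?\<Phi> t \<le> \<delta> s - \<delta> t" if "t < s" "s < 1" for s
          using copula_increment_le_diagonal[OF C, of x t s] xy t t01 that by (simp add: clamp01_eq)
        then show "\<forall>\<^sub>F s in at_right t. ?\<Phi> s - ?\<Phi> t \<le> \<delta> s - \<delta> t"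
          using t01 by (intro eventually_at_rightI[of t 1]) auto
      qed
      moreover have "\<phi> t \<le> 1" by (rule one_lipschitz_mono_derivative_bounds(2)[OF \<Phi> elim(3)])
      \<comment> \<open>For d = 0 the bound by d decides, for d = 2 the bound by 1.\<close>
      ultimately show "\<phi> t \<le> q t" using d(1) dq by auto
    qed
  qed
  from has_integral_le_AE[OF \<phi>[OF xy(2)] q[OF xy(2)] this]
  have "C x y - C x x \<le> (\<delta> y - \<delta> x) / 2" using xy by (simp add: clamp01_eq diff_divide_distrib)
  moreover have "C x x = \<delta> x" using C(2) xy by (auto simp: has_diagonal_def)
  ultimately have "C x y \<le> (\<delta> x + \<delta> y) / 2" by (simp add: field_simps)
  with copula_le_min[OF C(1), of x y] xy show ?thesis by (simp add: diagonal_copula_def)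
qed

text \<open>The hypothesis is tested on the asymmetric copula that puts as much mass above the
  diagonal as possible, and the resulting inequality is differentiated at points with \<delta> t <
  t.\<close>

lemma derivative_0_2_if_copula_le_diagonal_copula:
  assumes \<delta>: "diagonal_section \<delta>"
    and le: "\<And>C x y. \<lbrakk>copula C; has_diagonal C \<delta>; 0 \<le> x; x \<le> y; y \<le> 1\<rbrakk> \<Longrightarrow> C x y \<le> diagonal_copula \<delta> x y"
  shows "AE t in lborel. t \<in> {0..1} \<and> \<delta> t < t \<longrightarrow> (\<exists>d\<in>{0, 2}. (\<delta> has_real_derivative d) (at t))"
proof -
  let ?D = "\<lambda>t. \<delta> (clamp01 t) / 2"
  have D: "one_lipschitz_mono ?D" by (rule one_lipschitz_mono_half_diagonal[OF \<delta>])
  obtain q where q01: "\<And>x. 0 \<le> q x" "\<And>x. q x \<le> 1"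
    and q: "\<And>a b. a \<le> b \<Longrightarrow> (q has_integral (?D b - ?D a)) {a..b}"
    using one_lipschitz_mono_density[OF D] by metis
  \<comment> \<open>With 2 q = \<delta>' almost everywhere, this is min(1, \<delta>'), the maximal
    rate above the diagonal.\<close>
  let ?w = "\<lambda>x. min 1 (2 * q x)"
  have "?w integrable_on {a..b}" for a b
  proof -
    have "q integrable_on {a..b}"
      using q[of a b] by (cases "a \<le> b") (auto simp: has_integral_integrable)
    then have "(\<lambda>x. 2 * q x) absolutely_integrable_on {a..b}"
      using q01 by (intro nonnegative_absolutely_integrable_1) (auto intro: integrable_on_mult_right)
    moreover have "(\<lambda>x. 1::real) absolutely_integrable_on {a..b}"
      by (intro nonnegative_absolutely_integrable_1) auto
    ultimately show ?thesis
      using absolutely_integrable_min_1 set_lebesgue_integral_eq_integral(1) by blast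
  qed
  then obtain W where W0: "W 0 = 0" and w: "\<And>a b. a \<le> b \<Longrightarrow> (?w has_integral (W b - W a)) {a..b}"
    using indefinite_integral_exists by blast
  \<comment> \<open>The rest of \<delta>' goes below the diagonal: the density of \<open>U\<close>
    is max(0, \<delta>' - 1), again in [0,1].\<close>
  define U where "U t = \<delta> (clamp01 t) - W t" for t
  have "((\<lambda>x. 2 * q x - ?w x) has_integral (U b - U a)) {a..b}" if "a \<le> b" for a b
    using has_integral_diff[OF has_integral_mult_right[OF q[OF that], of 2] w[OF that]]
    by (simp add: U_def algebra_simps)
  then have U: "one_lipschitz_mono U"
  proof (rule one_lipschitz_monoI_density[rotated 2])
    show "0 \<le> 2 * q x - ?w x" "2 * q x - ?w x \<le> 1" for x
      using q01[of x] by (auto simp: min_def)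
  qed
  have W: "one_lipschitz_mono W"
    using q01 by (intro one_lipschitz_monoI_density[OF _ _ w]) auto
  have UW: "U t + W t = \<delta> t" if "t \<in> {0..1}" for t
    using that by (simp add: U_def clamp01_eq)
  have \<delta>_le: "\<delta> t \<le> t" if "t \<in> {0..1}" for t
    using \<delta> that unfolding diagonal_section_def by auto
  let ?C = "split_copula U W"
  have C: "copula ?C"
  proof (rule copula_split_copula[OF U _ W W0])
    show "U 0 = 0" using diagonal_section_0[OF \<delta>] by (simp add: U_def W0 clamp01_eq)
    show "U 1 + W 1 = 1" using UW[of 1] \<delta> by (simp add: diagonal_section_def)
  qed (use UW \<delta>_le in auto)
  have Cst: "?C s t = min s (\<delta> s + (W t - W s))" if "0 \<le> s" "s \<le> t" "t \<le> 1" for s t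
    using split_copula_above_diagonal[OF U, of t W s] UW[of t] UW[of s] \<delta>_le[of t] that
    by (simp add: algebra_simps)
  have diag: "has_diagonal ?C \<delta>"
    using Cst \<delta>_le by (auto simp: has_diagonal_def)
  have D': "AE t in lborel. (?D has_real_derivative q t) (at t)"
    by (rule AE_has_real_derivative_integral[OF q])
  have "AE t in lborel. (W has_real_derivative ?w t) (at t)"
    by (rule AE_has_real_derivative_integral[OF w])
  with D' show ?thesis
  proof eventually_elim
    case (elim t)
    show ?case
    proof
      assume t: "t \<in> {0..1} \<and> \<delta> t < t"
      \<comment> \<open>Both 0 and 1 are fixed by \<delta>, so the strict inequality excludes
        them.\<close>
      then have t01: "0 < t" "t < 1"
        using \<delta> diagonal_section_0[OF \<delta>]
        by (auto simp: diagonal_section_def order.strict_iff_order)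
      have "isCont ?D t"
        using one_lipschitz_mono_continuous[OF D] by (simp add: continuous_on_eq_continuous_at)
      then have "(?D \<longlongrightarrow> ?D t) (at_right t)"
        unfolding isCont_def by (rule filterlim_mono) (auto simp: at_le)
      \<comment> \<open>The threshold says that (\<delta> t + \<delta> y)/2 < t for y close to t.
        There the value t is not attained by either minimum, and the comparison of copulas becomes
        one of increments.\<close>
      moreover have "?D t < t - \<delta> t / 2" using t by (simp add: clamp01_eq)
      ultimately have "\<forall>\<^sub>F y in at_right t. ?D y < t - \<delta> t / 2"
        by (rule order_tendstoD)
      moreover have "\<forall>\<^sub>F y in at_right t. y \<in> {t<..<1}"
        using t01 by (intro eventually_at_rightI[of t 1]) auto
      ultimately have "\<forall>\<^sub>F y in at_right t. W y - W t \<le> ?D y - ?D t"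
      proof eventually_elim
        case (elim y)
        then show ?case
          using le[OF C diag, of t y] Cst[of t y] t t01
          by (auto simp: clamp01_eq diagonal_copula_def min_def field_simps split: if_splits)
      qed
      \<comment> \<open>For q in [0,1], min(1, 2 q) \<le> q forces q = 0 or q = 1.\<close>
      from derivative_le_right[OF elim(2,1) this] have "2 * q t \<in> {0, 2}"
        using q01[of t] by (auto simp: min_def split: if_splits)
      moreover have "(\<delta> has_real_derivative (2 * q t)) (at t)"
        using elim(1) half_diagonal_derivative_iff[OF t01] by simp
      ultimately show "\<exists>d\<in>{0, 2}. (\<delta> has_real_derivative d) (at t)" by blast
    qed
  qed
qed

theorem theorem3p8:
  fixes \<delta> :: "real \<Rightarrow> real"
  assumes "diagonal_section \<delta>"
  shows "(\<forall>x\<in>{0..1}. \<forall>y\<in>{0..1}. Cbar \<delta> x y = Ksym \<delta> x y) \<longleftrightarrow>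
         (AE x in lborel. x \<in> {t\<in>{0..1}. \<delta> t < t} \<longrightarrow>
            (\<exists>d\<in>{0, 2}. (\<delta> has_real_derivative d) (at x)))"
  unfolding Cbar_eq_Ksym_iff[OF assms]
proof
  assume "\<forall>C x y. copula C \<and> has_diagonal C \<delta> \<and> 0 \<le> x \<and> x \<le> y \<and> y \<le> 1 \<longrightarrow> C x y \<le> diagonal_copula \<delta> x y"
  then show "AE x in lborel. x \<in> {t\<in>{0..1}. \<delta> t < t} \<longrightarrow> (\<exists>d\<in>{0, 2}. (\<delta> has_real_derivative d) (at x))"
    using derivative_0_2_if_copula_le_diagonal_copula[OF assms] by simp
next
  assume AE: "AE x in lborel. x \<in> {t\<in>{0..1}. \<delta> t < t} \<longrightarrow> (\<exists>d\<in>{0, 2}. (\<delta> has_real_derivative d) (at x))"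
  show "\<forall>C x y. copula C \<and> has_diagonal C \<delta> \<and> 0 \<le> x \<and> x \<le> y \<and> y \<le> 1 \<longrightarrow> C x y \<le> diagonal_copula \<delta> x y"
  proof (intro allI impI, elim conjE)
    fix C x y assume C: "copula C" "has_diagonal C \<delta>" and xy: "0 \<le> x" "x \<le> y" "y \<le> (1::real)"
    show "C x y \<le> diagonal_copula \<delta> x y"
    \<comment> \<open>Without a fixed point in [x,y], the whole open interval lies in the set where
      the derivative hypothesis applies.\<close>
    proof (cases "\<exists>t\<in>{x..y}. \<delta> t = t")
      case True
      then show ?thesis
        using copula_le_diagonal_copula_if_fixpoint[OF assms C(1) xy(1) _ _ xy(3)] by auto
    next
      case False
      have "\<delta> t < t" if "t \<in> {x<..<y}" for t
        using False that assms xy by (force simp: diagonal_section_def order.strict_iff_order)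
      with AE xy have "AE t in lborel. t \<in> {x<..<y} \<longrightarrow> (\<exists>d\<in>{0, 2}. (\<delta> has_real_derivative d) (at t))"
        by (auto elim!: eventually_mono)
      then show ?thesis by (rule copula_le_diagonal_copula_if_derivative_0_2[OF assms C xy])
    qed
  qed
qed

end
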